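(* Let $r\geq 2$ and $n\geq 2$ be integers, let $I\subset\mathbb{R}$ be an interval, and let $e_1,e_2,e_3\in\mathbb{R}^{n+1}$ be mutually perpendicular vectors with $|e_1|^2=|e_2|^2=\frac{1}{r}$ and $|e_3|^2=\frac{r-1}{r}$. Then the curve $\gamma\colon I\to\mathbb{S}^n$ given by $$\gamma(s)=\cos(\sqrt{r}\,s)\,e_1+\sin(\sqrt{r}\,s)\,e_2+e_3$$ is a proper $r$-harmonic curve which is parametrized by arclength.
   Context: $\mathbb{S}^n\subset\mathbb{R}^{n+1}$ is the unit sphere with its round metric (constant sectional curvature $1$). For a smooth curve $\gamma\colon I\to N$ into a Riemannian manifold $(N,h)$, $T=\gamma'$ is its tangent vector, $\nabla_T$ is the covariant derivative along $\gamma$ (induced by the Levi-Civita connection of $N$), and $\nabla_T^jT$ denotes its $j$-fold iterate applied to $T$, with $\nabla_T^0T=T$. The curve $\gamma$ is called $r$-harmonic (polyharmonic of order $r$) if it is a critical point of the $r$-energy $E_r(\gamma)=\int_I|\nabla_T^{r-1}T|^2\,ds$, i.e. if it solves $$\nabla^{2r-1}_TT+\sum_{l=0}^{r-2}(-1)^lR^N(\nabla_T^{2r-3-l}T,\nabla_T^lT)T=0,$$ where $R^N$ is the curvature tensor of $N$, with sign convention such that on a space form of sectional curvature $K$ one has $R^N(X,Y)Z=K(\langle Z,Y\rangle X-\langle Z,X\rangle Y)$. An $r$-harmonic curve is called proper if it is not a geodesic. *)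

theory Defs
  imports "HOL-Analysis.Analysis"
begin

text \<open>
  Curves in the unit sphere of a Euclidean space, parametrised over an interval that may contain
  end points. All derivatives are taken within the interval (one-sided at end points); they are
  unique as soon as the interval has nonempty interior.
\<close>

definition smooth_on_interval :: "real set \<Rightarrow> (real \<Rightarrow> 'a::real_normed_vector) \<Rightarrow> bool" where
  "smooth_on_interval I f \<longleftrightarrow>
     (\<exists>D :: nat \<Rightarrow> real \<Rightarrow> 'a. (\<forall>s\<in>I. D 0 s = f s) \<and>
        (\<forall>k. \<forall>s\<in>I. (D k has_vector_derivative D (Suc k) s) (at s within I)))"

definition smooth_sphere_curve :: "real set \<Rightarrow> (real \<Rightarrow> 'a::euclidean_space) \<Rightarrow> bool" where
  "smooth_sphere_curve I \<gamma> \<longleftrightarrow> smooth_on_interval I \<gamma> \<and> (\<forall>s\<in>I. \<gamma> s \<in> sphere 0 1)"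

definition velocity :: "real set \<Rightarrow> (real \<Rightarrow> 'a::euclidean_space) \<Rightarrow> real \<Rightarrow> 'a" where
  "velocity I \<gamma> s = vector_derivative \<gamma> (at s within I)"

text \<open>
  The tangent space of the unit sphere at \<open>p\<close> is the orthogonal complement of \<open>p\<close>, and the
  Levi-Civita connection of the round metric is the tangential part of the flat connection of the
  ambient space. Hence the covariant derivative of a vector field \<open>X\<close> along \<open>\<gamma>\<close> is the orthogonal
  projection of the ordinary derivative of \<open>X\<close> to the tangent space at \<open>\<gamma> s\<close>.
\<close>

definition tangent_proj :: "'a::euclidean_space \<Rightarrow> 'a \<Rightarrow> 'a" where
  "tangent_proj p v = v - (v \<bullet> p) *\<^sub>R p"

definition cov_deriv ::
    "real set \<Rightarrow> (real \<Rightarrow> 'a::euclidean_space) \<Rightarrow> (real \<Rightarrow> 'a) \<Rightarrow> real \<Rightarrow> 'a" where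
  "cov_deriv I \<gamma> X s = tangent_proj (\<gamma> s) (vector_derivative X (at s within I))"

definition cov_deriv_iter ::
    "real set \<Rightarrow> (real \<Rightarrow> 'a::euclidean_space) \<Rightarrow> nat \<Rightarrow> real \<Rightarrow> 'a" where
  "cov_deriv_iter I \<gamma> j = (cov_deriv I \<gamma> ^^ j) (velocity I \<gamma>)"

text \<open>Curvature tensor \<open>R(X,Y)Z\<close> of the round unit sphere, the space form of curvature \<open>1\<close>.\<close>

definition sphere_curvature :: "'a::euclidean_space \<Rightarrow> 'a \<Rightarrow> 'a \<Rightarrow> 'a" where
  "sphere_curvature X Y Z = (Z \<bullet> Y) *\<^sub>R X - (Z \<bullet> X) *\<^sub>R Y"

text \<open>
  The Euler-Lagrange equation of the \<open>r\<close>-energy, for \<open>r \<ge> 1\<close>. The summation range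
  \<open>0 \<le> l \<le> r - 2\<close> is written as \<open>l < r - 1\<close>, so that it is empty for \<open>r = 1\<close>; on it the
  natural number \<open>2 * r - 3 - l\<close> involves no truncation.
\<close>

definition r_harmonic_curve :: "nat \<Rightarrow> real set \<Rightarrow> (real \<Rightarrow> 'a::euclidean_space) \<Rightarrow> bool" where
  "r_harmonic_curve r I \<gamma> \<longleftrightarrow> smooth_sphere_curve I \<gamma> \<and>
     (\<forall>s\<in>I. cov_deriv_iter I \<gamma> (2 * r - 1) s
        + (\<Sum>l<r - 1. (-1) ^ l *\<^sub>R
             sphere_curvature (cov_deriv_iter I \<gamma> (2 * r - 3 - l) s) (cov_deriv_iter I \<gamma> l s)
               (velocity I \<gamma> s)) = 0)"

definition geodesic :: "real set \<Rightarrow> (real \<Rightarrow> 'a::euclidean_space) \<Rightarrow> bool" where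
  "geodesic I \<gamma> \<longleftrightarrow>
     smooth_sphere_curve I \<gamma> \<and> (\<forall>s\<in>I. cov_deriv I \<gamma> (velocity I \<gamma>) s = 0)"

definition proper_r_harmonic_curve ::
    "nat \<Rightarrow> real set \<Rightarrow> (real \<Rightarrow> 'a::euclidean_space) \<Rightarrow> bool" where
  "proper_r_harmonic_curve r I \<gamma> \<longleftrightarrow> r_harmonic_curve r I \<gamma> \<and> \<not> geodesic I \<gamma>"

definition arclength_parametrized :: "real set \<Rightarrow> (real \<Rightarrow> 'a::euclidean_space) \<Rightarrow> bool" where
  "arclength_parametrized I \<gamma> \<longleftrightarrow> (\<forall>s\<in>I. norm (velocity I \<gamma> s) = 1)"

end

theory Submission
  imports Defs
begin

text \<open>
  Write \<open>u\<close> for the circular part of \<open>\<gamma>\<close>, \<open>T = \<gamma>'\<close> and \<open>N = (1 - r) u + e3\<close>. Then \<open>T\<close>, \<open>N\<close>, \<open>\<gamma>\<close> are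
  pairwise orthogonal, \<open>T' = N - \<gamma>\<close> and \<open>N' = (1 - r) T\<close>, so that \<open>\<nabla>T = N\<close> and \<open>\<nabla>N = \<kappa> T\<close> with
  \<open>\<kappa> = 1 - r\<close>. The iterated covariant derivatives of \<open>T\<close> are therefore \<open>\<kappa>^k T\<close> and \<open>\<kappa>^k N\<close> in turn,
  every one of the \<open>r - 1\<close> curvature terms equals \<open>\<kappa>^(r - 2) N\<close>, and the Euler-Lagrange equation
  becomes \<open>\<kappa>^(r - 2) (\<kappa> + r - 1) N = 0\<close>.
\<close>

text \<open>A connected set other than a singleton has no isolated points. This is what makes
  one-sided derivatives at end points unique.\<close>

lemma interval_at_within_neq_bot:
  fixes I :: "real set"
  assumes "is_interval I" "interior I \<noteq> {}" "s \<in> I"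
  shows "at s within I \<noteq> bot"
proof -
  have "connected I"
    using assms(1) by (simp add: is_interval_connected)
  moreover have "I \<noteq> {s}"
    using assms(2) by auto
  ultimately have "s islimpt I"
    using assms(3) connected_imp_perfect by blast
  then show ?thesis
    by (simp add: trivial_limit_within)
qed

text \<open>Agreement on \<open>I\<close> is enough, since the derivative is taken within
  \<open>I\<close>; the curve and the fields along it are known only there.\<close>

lemma vector_derivative_within_eqI:
  assumes "is_interval I" "interior I \<noteq> {}" "s \<in> I"
    and "\<And>t. t \<in> I \<Longrightarrow> X t = Y t"
    and "(Y has_vector_derivative Y') (at s within I)"
  shows "vector_derivative X (at s within I) = Y'"
  by (metis assms has_vector_derivative_transform interval_at_within_neq_bot
      vector_derivative_within)

lemma cov_deriv_iter_0: "cov_deriv_iter I \<gamma> 0 = velocity I \<gamma>"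
  by (simp add: cov_deriv_iter_def)

lemma cov_deriv_iter_Suc: "cov_deriv_iter I \<gamma> (Suc j) = cov_deriv I \<gamma> (cov_deriv_iter I \<gamma> j)"
  by (simp add: cov_deriv_iter_def)

lemma tangent_proj_scaleR: "tangent_proj p (c *\<^sub>R v) = c *\<^sub>R tangent_proj p v"
  by (simp add: tangent_proj_def algebra_simps)

text \<open>The assumption on \<open>T'\<close> expresses \<open>\<nabla>T = N\<close>: differentiating \<open>T \<bullet> \<gamma> = 0\<close> shows that the normal
  part of \<open>T'\<close> is \<open>-\<gamma>\<close>.\<close>

locale unit_speed_sphere_curve =
  fixes I :: "real set" and \<gamma> T N :: "real \<Rightarrow> 'a::euclidean_space" and \<kappa> :: real
  assumes interval: "is_interval I" "interior I \<noteq> {}"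
    and norm_curve: "\<And>s. s \<in> I \<Longrightarrow> norm (\<gamma> s) = 1"
    and norm_T: "\<And>s. s \<in> I \<Longrightarrow> norm (T s) = 1"
    and T_curve: "\<And>s. s \<in> I \<Longrightarrow> T s \<bullet> \<gamma> s = 0"
    and N_curve: "\<And>s. s \<in> I \<Longrightarrow> N s \<bullet> \<gamma> s = 0"
    and T_N: "\<And>s. s \<in> I \<Longrightarrow> T s \<bullet> N s = 0"
    and deriv_curve: "\<And>s. s \<in> I \<Longrightarrow> (\<gamma> has_vector_derivative T s) (at s within I)"
    and deriv_T: "\<And>s. s \<in> I \<Longrightarrow> (T has_vector_derivative N s - \<gamma> s) (at s within I)"
    and deriv_N: "\<And>s. s \<in> I \<Longrightarrow> (N has_vector_derivative \<kappa> *\<^sub>R T s) (at s within I)"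
begin

lemma velocity_eq: "s \<in> I \<Longrightarrow> velocity I \<gamma> s = T s"
  unfolding velocity_def
  by (rule vector_derivative_within_eqI[OF interval]) (auto intro: deriv_curve)

text \<open>The projection removes the normal part \<open>- \<gamma> s\<close> of the derivative of
  \<open>T\<close>. The factor \<open>c\<close> allows repeated use on the iterates.\<close>

lemma cov_deriv_T:
  assumes "s \<in> I" "\<And>t. t \<in> I \<Longrightarrow> X t = c *\<^sub>R T t"
  shows "cov_deriv I \<gamma> X s = c *\<^sub>R N s"
proof -
  have "((\<lambda>t. c *\<^sub>R T t) has_vector_derivative c *\<^sub>R (N s - \<gamma> s)) (at s within I)"
    using deriv_T[OF assms(1)] bounded_linear.has_vector_derivative[OF bounded_linear_scaleR_right]
    by blast
  then have "vector_derivative X (at s within I) = c *\<^sub>R (N s - \<gamma> s)"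
    using assms by (intro vector_derivative_within_eqI[OF interval])
  moreover have "tangent_proj (\<gamma> s) (N s - \<gamma> s) = N s"
    using N_curve[OF assms(1)] norm_curve[OF assms(1)]
    by (simp add: tangent_proj_def inner_diff_left norm_eq_1)
  ultimately show ?thesis
    by (simp add: cov_deriv_def tangent_proj_scaleR)
qed

lemma cov_deriv_N:
  assumes "s \<in> I" "\<And>t. t \<in> I \<Longrightarrow> X t = c *\<^sub>R N t"
  shows "cov_deriv I \<gamma> X s = (c * \<kappa>) *\<^sub>R T s"
proof -
  have "((\<lambda>t. c *\<^sub>R N t) has_vector_derivative c *\<^sub>R (\<kappa> *\<^sub>R T s)) (at s within I)"
    using deriv_N[OF assms(1)] bounded_linear.has_vector_derivative[OF bounded_linear_scaleR_right]
    by blast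
  then have "vector_derivative X (at s within I) = c *\<^sub>R (\<kappa> *\<^sub>R T s)"
    using assms by (intro vector_derivative_within_eqI[OF interval])
  moreover have "tangent_proj (\<gamma> s) (T s) = T s"
    using T_curve[OF assms(1)] by (simp add: tangent_proj_def)
  ultimately show ?thesis
    by (simp add: cov_deriv_def tangent_proj_scaleR)
qed

text \<open>Covariant differentiation alternates between multiples of \<open>T\<close> and of
  \<open>N\<close>, and only the passage from \<open>N\<close> to \<open>T\<close> contributes a
  factor \<kappa>.\<close>

lemma cov_deriv_iter_even_odd:
  "\<forall>s\<in>I. cov_deriv_iter I \<gamma> (2 * k) s = \<kappa> ^ k *\<^sub>R T s \<and>
    cov_deriv_iter I \<gamma> (Suc (2 * k)) s = \<kappa> ^ k *\<^sub>R N s"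
proof (induction k)
  case 0
  then show ?case
    using velocity_eq cov_deriv_T[where c = 1] by (simp add: cov_deriv_iter_0 cov_deriv_iter_Suc)
next
  case (Suc k)
  \<comment> \<open>This is needed on all of \<open>I\<close>, because the odd case differentiates
    it once more.\<close>
  have even: "cov_deriv_iter I \<gamma> (2 * Suc k) s = \<kappa> ^ Suc k *\<^sub>R T s" if "s \<in> I" for s
    using cov_deriv_N[OF that, where c = "\<kappa> ^ k"] Suc
    by (simp add: cov_deriv_iter_Suc mult.commute)
  then show ?case
    using cov_deriv_T[OF _ even] by (metis cov_deriv_iter_Suc)
qed

lemmas cov_deriv_iter_even = cov_deriv_iter_even_odd[rule_format, THEN conjunct1]
lemmas cov_deriv_iter_odd = cov_deriv_iter_even_odd[rule_format, THEN conjunct2]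

text \<open>The two indices add up to \<open>2 * m + 1\<close>, so one field is a multiple of
  \<open>T\<close>, the other of \<open>N\<close>, and the powers of \<kappa> multiply to
  \<open>\<kappa> ^ m\<close>. For even \<open>l\<close> the curvature is R(N,T)T = N; for odd
  \<open>l\<close> it is R(T,N)T = -N, and the sign \<open>(-1) ^ l\<close> compensates.\<close>

lemma curvature_term:
  assumes "s \<in> I" "l \<le> m"
  shows "(-1) ^ l *\<^sub>R sphere_curvature (cov_deriv_iter I \<gamma> (Suc (2 * m) - l) s)
      (cov_deriv_iter I \<gamma> l s) (velocity I \<gamma> s) = \<kappa> ^ m *\<^sub>R N s"
proof -
  have TT: "T s \<bullet> T s = 1"
    using norm_T[OF assms(1)] by (simp add: norm_eq_1)
  show ?thesis
  proof (cases "even l")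
    case True
    then obtain k where k: "l = 2 * k" by blast
    then have "Suc (2 * m) - l = Suc (2 * (m - k))" "k \<le> m" using assms(2) by auto
    then show ?thesis
      using TT assms(1) T_N[OF assms(1)] k
      by (simp add: cov_deriv_iter_even cov_deriv_iter_odd velocity_eq sphere_curvature_def
          flip: power_add)
  next
    case False
    then obtain k where k: "l = Suc (2 * k)" by (metis oddE Suc_eq_plus1)
    then have "Suc (2 * m) - l = 2 * (m - k)" "k \<le> m" using assms(2) by auto
    then show ?thesis
      using TT assms(1) T_N[OF assms(1)] k
      by (simp add: cov_deriv_iter_even cov_deriv_iter_odd velocity_eq sphere_curvature_def
          flip: power_add)
  qed
qed

lemma euler_lagrange:
  assumes "s \<in> I" "r \<ge> 2"
  shows "cov_deriv_iter I \<gamma> (2 * r - 1) s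
      + (\<Sum>l<r - 1. (-1) ^ l *\<^sub>R
           sphere_curvature (cov_deriv_iter I \<gamma> (2 * r - 3 - l) s) (cov_deriv_iter I \<gamma> l s)
             (velocity I \<gamma> s))
    = (\<kappa> ^ (r - 2) * (\<kappa> + real (r - 1))) *\<^sub>R N s"
proof -
  \<comment> \<open>This substitution turns all truncated differences in the indices into
    successors.\<close>
  obtain m where r: "r = m + 2"
    using assms(2) le_Suc_ex by (metis add.commute)
  have idx: "2 * r - 1 = Suc (2 * Suc m)" "2 * r - 3 = Suc (2 * m)" "r - 1 = Suc m" "r - 2 = m"
    using r by auto
  have "(\<Sum>l<Suc m. (-1) ^ l *\<^sub>R
           sphere_curvature (cov_deriv_iter I \<gamma> (Suc (2 * m) - l) s) (cov_deriv_iter I \<gamma> l s)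
             (velocity I \<gamma> s)) = (\<Sum>l<Suc m. \<kappa> ^ m *\<^sub>R N s)"
    by (rule sum.cong) (auto simp: curvature_term[OF assms(1)])
  also have "\<dots> = (real (Suc m) * \<kappa> ^ m) *\<^sub>R N s"
    by (simp add: sum_constant_scaleR del: sum.lessThan_Suc)
  finally show ?thesis
    unfolding idx using cov_deriv_iter_odd[OF assms(1), of "Suc m"]
    by (simp add: algebra_simps)
qed

end

text \<open>Writing the derivative as a phase shift by a quarter turn keeps its shape, so that
  derivatives of every order have one closed form.\<close>

lemma has_vector_derivative_circle:
  fixes e1 e2 :: "'a::real_normed_vector"
  shows "((\<lambda>s. cos (a * s + b) *\<^sub>R e1 + sin (a * s + b) *\<^sub>R e2) has_vector_derivative
    a *\<^sub>R (cos (a * s + (b + pi / 2)) *\<^sub>R e1 + sin (a * s + (b + pi / 2)) *\<^sub>R e2)) (at s within I)"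
proof -
  have "cos (a * s + (b + pi / 2)) = - sin (a * s + b)" "sin (a * s + (b + pi / 2)) = cos (a * s + b)"
    by (simp_all add: cos_add sin_add flip: add.assoc)
  then show ?thesis
    by (auto intro!: derivative_eq_intros simp: has_vector_derivative_def algebra_simps)
qed

lemma smooth_on_interval_circle:
  fixes e1 e2 e3 :: "'a::real_normed_vector"
  assumes "\<And>s. s \<in> I \<Longrightarrow> f s = cos (a * s) *\<^sub>R e1 + sin (a * s) *\<^sub>R e2 + e3"
  shows "smooth_on_interval I f"
proof -
  define C where "C k s = cos (a * s + real k * (pi / 2)) *\<^sub>R e1 + sin (a * s + real k * (pi / 2)) *\<^sub>R e2"
    for k s
  have C: "(C k has_vector_derivative a *\<^sub>R C (Suc k) s) (at s within I)" for k s
  proof -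
    have "real k * (pi / 2) + pi / 2 = real (Suc k) * (pi / 2)"
      by (simp add: algebra_simps)
    then show ?thesis
      using has_vector_derivative_circle[of a "real k * (pi / 2)" e1 e2 s I]
      unfolding C_def by (simp only:)
  qed
  \<comment> \<open>The constant \<open>e3\<close> survives only in the derivative of order
    zero.\<close>
  define D where "D k s = a ^ k *\<^sub>R C k s + (if k = 0 then e3 else 0)" for k s
  have "(D k has_vector_derivative D (Suc k) s) (at s within I)" for k s
    unfolding D_def
    by (rule derivative_eq_intros C
          bounded_linear.has_vector_derivative[OF bounded_linear_scaleR_right] refl)+
       (simp add: mult.commute)
  moreover have "D 0 s = f s" if "s \<in> I" for s
    using assms[OF that] by (simp add: D_def C_def)
  ultimately show ?thesis
    unfolding smooth_on_interval_def by blast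
qed

theorem theorem1p5:
  fixes r n :: nat
    and I :: "real set"
    and e1 e2 e3 :: "real ^ 'm"
    and \<gamma> :: "real \<Rightarrow> real ^ 'm"
  assumes "r \<ge> 2" and "n \<ge> 2"
    and "CARD('m) = n + 1"
    and "is_interval I" and "interior I \<noteq> {}"
    and "orthogonal e1 e2" and "orthogonal e1 e3" and "orthogonal e2 e3"
    and "(norm e1)\<^sup>2 = 1 / real r" and "(norm e2)\<^sup>2 = 1 / real r"
    and "(norm e3)\<^sup>2 = (real r - 1) / real r"
    and "\<And>s. s \<in> I \<Longrightarrow>
           \<gamma> s = cos (sqrt (real r) * s) *\<^sub>R e1 + sin (sqrt (real r) * s) *\<^sub>R e2 + e3"
  shows "proper_r_harmonic_curve r I \<gamma> \<and> arclength_parametrized I \<gamma>"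
proof -
  define a where "a = sqrt (real r)"
  have aa: "a * a = real r"
    by (simp add: a_def)
  define u where "u s = cos (a * s) *\<^sub>R e1 + sin (a * s) *\<^sub>R e2" for s
  define T where "T s = a *\<^sub>R (cos (a * s) *\<^sub>R e2 - sin (a * s) *\<^sub>R e1)" for s
  \<comment> \<open>Since T' = -r u, this is T' + \<gamma>, the tangential part of the
    acceleration.\<close>
  define N where "N s = (1 - real r) *\<^sub>R u s + e3" for s
  have curve: "\<gamma> s = u s + e3" if "s \<in> I" for s
    using assms(12)[OF that] by (simp add: a_def u_def)
  have inner_e: "e1 \<bullet> e1 = 1 / real r" "e2 \<bullet> e2 = 1 / real r" "e3 \<bullet> e3 = (real r - 1) / real r"
    "e1 \<bullet> e2 = 0" "e2 \<bullet> e1 = 0" "e1 \<bullet> e3 = 0" "e3 \<bullet> e1 = 0" "e2 \<bullet> e3 = 0" "e3 \<bullet> e2 = 0"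
    using assms(6-11) by (auto simp: power2_norm_eq_inner orthogonal_def inner_commute)
  have rpos: "real r > 0" using assms(1) by simp
  note inner_simps = inner_e inner_add_left inner_add_right inner_diff_left inner_diff_right
  \<comment> \<open>The circle has radius \<open>1 / a\<close> and angular speed \<open>a\<close>,
    hence unit speed.\<close>
  have u_u: "u s \<bullet> u s = 1 / real r" and T_T: "T s \<bullet> T s = 1" for s
  proof -
    let ?c = "cos (a * s)" and ?s = "sin (a * s)"
    have cs: "?c * ?c + ?s * ?s = 1"
      by (rule sin_cos_squared_add3)
    have "u s \<bullet> u s = (?c * ?c + ?s * ?s) / r"
      by (simp add: u_def inner_simps add_divide_distrib del: sin_cos_squared_add3)
    then show "u s \<bullet> u s = 1 / real r"
      unfolding cs .
    have "T s \<bullet> T s = (a * a) * ((?c * ?c + ?s * ?s) / r)"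
      unfolding T_def
      by (simp add: inner_simps algebra_simps add_divide_distrib del: sin_cos_squared_add3)
    then show "T s \<bullet> T s = 1"
      using rpos unfolding cs by (simp add: aa)
  qed
  have u_e3: "u s \<bullet> e3 = 0" "e3 \<bullet> u s = 0" and T_u: "T s \<bullet> u s = 0" and T_e3: "T s \<bullet> e3 = 0" for s
    by (simp_all add: u_def T_def inner_simps algebra_simps)
  have deriv_u: "(u has_vector_derivative T s) (at s within I)" for s
    unfolding u_def T_def
    by (auto intro!: derivative_eq_intros simp: has_vector_derivative_def algebra_simps)
  interpret unit_speed_sphere_curve I \<gamma> T N "1 - real r"
  proof
    show "is_interval I" "interior I \<noteq> {}" by fact+
  next
    fix s assume s: "s \<in> I"
    show "norm (\<gamma> s) = 1"
      using rpos by (simp add: curve[OF s] norm_eq_1 inner_add_left inner_add_right u_u u_e3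
          inner_e(3) flip: add_divide_distrib)
    show "norm (T s) = 1"
      by (simp add: norm_eq_1 T_T)
    show "T s \<bullet> \<gamma> s = 0"
      by (simp add: curve[OF s] inner_add_right T_u T_e3)
    \<comment> \<open>The prescribed lengths give (1 - r)/r + (r - 1)/r = 0.\<close>
    show "N s \<bullet> \<gamma> s = 0"
      by (simp add: curve[OF s] N_def inner_add_left inner_add_right u_u u_e3 inner_e(3)
          flip: add_divide_distrib)
    show "T s \<bullet> N s = 0"
      by (simp add: N_def inner_add_right T_u T_e3)
    have "((\<lambda>s. u s + e3) has_vector_derivative T s) (at s within I)"
      using has_vector_derivative_add[OF deriv_u has_vector_derivative_const[of e3]] by simp
    then show "(\<gamma> has_vector_derivative T s) (at s within I)"
      by (intro has_vector_derivative_transform[OF s curve])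
    have eq: "N s - \<gamma> s = - (a * a) *\<^sub>R (cos (a * s) *\<^sub>R e1 + sin (a * s) *\<^sub>R e2)"
      unfolding N_def curve[OF s] u_def aa by (simp add: algebra_simps)
    show "(T has_vector_derivative N s - \<gamma> s) (at s within I)"
      unfolding eq T_def
      by (auto intro!: derivative_eq_intros simp: has_vector_derivative_def algebra_simps)
    show "(N has_vector_derivative (1 - real r) *\<^sub>R T s) (at s within I)"
      unfolding N_def
      using has_vector_derivative_add[OF
          bounded_linear.has_vector_derivative[OF bounded_linear_scaleR_right deriv_u]
          has_vector_derivative_const[of e3]] by simp
  qed
  have smooth: "smooth_sphere_curve I \<gamma>"
    unfolding smooth_sphere_curve_def
    using smooth_on_interval_circle[of I \<gamma>, OF curve[unfolded u_def]] norm_curve by auto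
  \<comment> \<open>With \<kappa> = 1 - r the factor \<open>\<kappa> + real (r - 1)\<close>
    vanishes.\<close>
  have "r_harmonic_curve r I \<gamma>"
    unfolding r_harmonic_curve_def
    using smooth euler_lagrange[OF _ assms(1)] assms(1) by (simp add: of_nat_diff)
  moreover have "\<not> geodesic I \<gamma>"
  proof
    assume "geodesic I \<gamma>"
    moreover obtain s where s: "s \<in> I"
      using assms(5) interior_subset by blast
    ultimately have "N s = 0"
      using cov_deriv_T[of s "velocity I \<gamma>" 1] velocity_eq by (simp add: geodesic_def)
    \<comment> \<open>On the other hand this inner product is the squared length of
      \<open>e3\<close>, which is positive for r \<ge> 2.\<close>
    then have "N s \<bullet> e3 = 0" by simp
    then show False
      using assms(1) by (simp add: N_def inner_add_left u_e3 inner_e(3))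
  qed
  moreover have "arclength_parametrized I \<gamma>"
    by (simp add: arclength_parametrized_def velocity_eq norm_T)
  ultimately show ?thesis
    by (simp add: proper_r_harmonic_curve_def)
qed

end
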